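(* The generating function $\phi(u,v)=1+\sum_{n\ge d\ge 1} \Xi(2n,d)u^n v^d$ satisfies \begin{equation*} \phi(u,v)= \frac{ \sin(\pi\sqrt{(1-v)u}/2)}{ \sqrt{1-v}\, \sin(\pi\sqrt{u}/2)}\cdot \frac{ \cosh(\pi\sqrt{(1-v)u}/2)}{ \cosh(\pi\sqrt{u}/2)}. \end{equation*}
   Context: For positive integers $s_1,\dots,s_d$ put $$\xi(2s_1,\dots,2s_d)=\sum_{n_1>\cdots>n_d\ge 1}\frac{(-1)^{s_1n_1}\cdots (-1)^{s_dn_d}}{ n_1^{2s_1}\cdots n_d^{2s_d}},$$ and for positive integers $d\le n$ put $$\Xi(2n,d)=\sum_{\substack{j_1+\cdots+j_d=n\\ j_1,\dots,j_d > 0}}\xi(2j_1,\dots,2j_d).$$ The sum defining $\phi$ runs over all pairs of integers $(n,d)$ with $n\ge d\ge 1$. The identity is one of power series in $u$ and $v$; in the right-hand side the square roots of $u$ and of $1-v$ cancel, so that it expands as a power series in $u,v$. *)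

theory Defs
  imports "HOL-Analysis.Analysis" "HOL-Computational_Algebra.Computational_Algebra"
begin

text \<open>\<open>xi [s\<^sub>1, \<dots>, s\<^sub>d]\<close> is \<open>\<xi>(2s\<^sub>1, \<dots>, 2s\<^sub>d)\<close> and \<open>Xi n d\<close> is \<open>\<Xi>(2n, d)\<close>.
  For positive \<open>s\<^sub>i\<close> the multiple series converges absolutely, so \<open>infsum\<close> is its value.\<close>

definition decreasing_tuples :: "nat \<Rightarrow> nat list set" where
  "decreasing_tuples d = {ns. length ns = d \<and> sorted_wrt (>) ns \<and> (\<forall>n\<in>set ns. n \<ge> 1)}"

definition xi :: "nat list \<Rightarrow> real" where
  "xi ss = (\<Sum>\<^sub>\<infinity>ns\<in>decreasing_tuples (length ss).
     \<Prod>i<length ss. (-1) ^ (ss ! i * ns ! i) / real (ns ! i) ^ (2 * ss ! i))"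

definition compositions :: "nat \<Rightarrow> nat \<Rightarrow> nat list set" where
  "compositions n d = {js. length js = d \<and> sum_list js = n \<and> (\<forall>j\<in>set js. j > 0)}"

lemma finite_compositions: "finite (compositions n d)"
proof (rule finite_subset)
  show "compositions n d \<subseteq> {js. set js \<subseteq> {..n} \<and> length js = d}"
    by (auto simp: compositions_def member_le_sum_list)
  show "finite {js. set js \<subseteq> {..n} \<and> length js = d}"
    by (rule finite_lists_length_eq) simp
qed

definition Xi :: "nat \<Rightarrow> nat \<Rightarrow> real" where
  "Xi n d = (\<Sum>js\<in>compositions n d. xi js)"

text \<open>Power series in \<open>u\<close> and \<open>v\<close>: the outer variable is \<open>u\<close>, the inner variable is \<open>v\<close>.\<close>

definition phi :: "real fps fps" where
  "phi = 1 + Abs_fps (\<lambda>n. Abs_fps (\<lambda>d. if 1 \<le> d \<and> d \<le> n then Xi n d else 0))"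

text \<open>To write the square roots (and quotients) literally, the identity is read in the larger ring
  \<open>\<real>((v))[[t]]\<close> with \<open>t = \<surd>u\<close>, in which \<open>1 - v\<close> has the square root with constant term \<open>1\<close>.
  \<open>at_sqrt_u\<close> is the injection \<open>\<real>[[v]][[u]] \<rightarrow> \<real>((v))[[t]]\<close>, \<open>u \<mapsto> t\<^sup>2\<close>.\<close>

definition at_sqrt_u :: "real fps fps \<Rightarrow> real fls fps" where
  "at_sqrt_u F = Abs_fps (\<lambda>n. fps_to_fls (F $ n)) oo fps_X ^ 2"

lemma at_sqrt_u_nth:
  "at_sqrt_u F $ k = (if even k then fps_to_fls (F $ (k div 2)) else 0)"
proof -
  have "at_sqrt_u F $ k = (\<Sum>i=0..k. fps_to_fls (F $ i) * (if k = 2 * i then 1 else 0))"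
    unfolding at_sqrt_u_def fps_compose_nth
    by (intro sum.cong refl) (simp flip: power_mult)
  also have "\<dots> = (\<Sum>i=0..k. if i = k div 2 \<and> even k then fps_to_fls (F $ i) else 0)"
    by (intro sum.cong refl) auto
  also have "\<dots> = (if even k then fps_to_fls (F $ (k div 2)) else 0)"
    by (auto simp: sum.delta)
  finally show ?thesis .
qed

lemma inj_at_sqrt_u: "inj at_sqrt_u"
proof (rule injI)
  fix F G assume "at_sqrt_u F = at_sqrt_u G"
  then have "at_sqrt_u F $ (2 * n) = at_sqrt_u G $ (2 * n)" for n by simp
  then show "F = G" by (simp add: at_sqrt_u_nth fps_eq_iff)
qed

definition sqrt_1_minus_v :: "real fls" where
  "sqrt_1_minus_v = fps_to_fls (fps_radical root 2 (1 - fps_X))"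

lemma sqrt_1_minus_v_power2: "sqrt_1_minus_v ^ 2 = 1 - fls_X"
proof -
  have "fps_radical root 2 (1 - fps_X :: real fps) ^ 2 = 1 - fps_X"
    using power_radical[of "1 - fps_X :: real fps" root 1] by (simp add: numeral_2_eq_2)
  then show ?thesis
    by (simp add: sqrt_1_minus_v_def flip: fps_to_fls_power)
qed

definition half_pi :: "real fls" where
  "half_pi = fls_const (pi / 2)"

text \<open>As for \<open>fps_sin\<close>, \<open>fps_cosh c\<close> is the expansion of \<open>cosh (c t)\<close> in the variable \<open>t\<close>.\<close>

definition fps_cosh :: "'a::field_char_0 \<Rightarrow> 'a fps" where
  "fps_cosh c = fps_const (1 / 2) * (fps_exp c + fps_exp (- c))"

end

theory Submission
  imports Defs "HOL-Complex_Analysis.Complex_Analysis"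
begin

text \<open>Write \<open>x m = (-1) ^ m / m\<^sup>2\<close>. Then \<open>\<xi>(2s\<^sub>1, \<dots>, 2s\<^sub>d)\<close> is the sum of
  \<open>x n\<^sub>1 ^ s\<^sub>1 * \<dots> * x n\<^sub>d ^ s\<^sub>d\<close> over \<open>n\<^sub>1 > \<dots> > n\<^sub>d \<ge> 1\<close>. Summing over all exponents first, every
  index \<open>m\<close> either does not occur or contributes \<open>v (x m u + (x m u)\<^sup>2 + \<dots>)\<close>, so
  \<open>\<phi>(u, v) = (\<Prod>m. 1 + v x m u / (1 - x m u)) = (\<Prod>m. (1 - (1 - v) x m u) / (1 - x m u))\<close>.
  So \<open>\<phi>(u, v) = S((1 - v) u) / S(u)\<close> with \<open>S(w) = (\<Prod>m. 1 - x m w)\<close>. The factors of even index form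
  the product of \<open>sin (\<pi>\<surd>w / 2) / (\<pi>\<surd>w / 2)\<close>, those of odd index the product of \<open>cosh (\<pi>\<surd>w / 2)\<close>.

  To make sense of the infinite products as formal power series, the factors are truncated at
  \<open>m \<le> N\<close>. The finite identity, taken coefficient by coefficient, is
  \<open>partial_product_mult_composition_series\<close>. As \<open>N\<close> grows, the truncated multiple sums converge
  by absolute summability (\<open>composition_series_tendsto_Xi\<close>), and the coefficients of the finite
  products converge to the Taylor coefficients of the limit function because the convergence is
  uniform near \<open>0\<close> in the complex plane (\<open>partial_product_alt_inv_square_tendsto\<close>). In the limit one gets
  \<open>\<phi>(u, v) S(u) = S((1 - v) u)\<close> (\<open>phi_mult_sin_cosh\<close>), which is the theorem up to division.\<close>

(* Here $ always denotes a coefficient of a power series. *)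
unbundle no vec_syntax

section \<open>Truncated multiple sums and finite products\<close>

text \<open>This is the sum of \<open>x n\<^sub>1 ^ j\<^sub>1 * \<dots> * x n\<^sub>d ^ j\<^sub>d\<close> over
  \<open>N \<ge> n\<^sub>1 > \<dots> > n\<^sub>d \<ge> 1\<close>; the last equation separates the tuples according to whether
  \<open>n\<^sub>1 = N + 1\<close>. The recursive form makes the induction on \<open>N\<close> below immediate.\<close>

fun truncated_sum :: "(nat \<Rightarrow> 'a::comm_ring_1) \<Rightarrow> nat \<Rightarrow> nat list \<Rightarrow> 'a" where
  "truncated_sum x N [] = 1"
| "truncated_sum x 0 (j # js) = 0"
| "truncated_sum x (Suc N) (j # js) =
     truncated_sum x N (j # js) + x (Suc N) ^ j * truncated_sum x N js"

text \<open>For \<open>x m = (-1) ^ m / m\<^sup>2\<close> this is, as a power series in \<open>u\<close>, the coefficient of \<open>v ^ d\<close> in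
  the truncation of \<open>phi\<close> to indices at most \<open>N\<close>.\<close>

definition composition_series :: "(nat \<Rightarrow> 'a::comm_ring_1) \<Rightarrow> nat \<Rightarrow> nat \<Rightarrow> 'a fps" where
  "composition_series x N d = Abs_fps (\<lambda>n. \<Sum>js\<in>compositions n d. truncated_sum x N js)"

definition partial_product :: "(nat \<Rightarrow> 'a::comm_ring_1) \<Rightarrow> nat \<Rightarrow> 'a fps" where
  "partial_product x N = (\<Prod>m=1..N. 1 - fps_const (x m) * fps_X)"

lemma compositions_0: "compositions n 0 = (if n = 0 then {[]} else {})"
  by (auto simp: compositions_def)

lemma compositions_Suc:
  "compositions n (Suc d) = (\<Union>j\<in>{1..n}. (#) j ` compositions (n - j) d)"
proof (intro equalityI subsetI)
  fix js assume "js \<in> compositions n (Suc d)"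
  then show "js \<in> (\<Union>j\<in>{1..n}. (#) j ` compositions (n - j) d)"
    by (cases js) (auto simp: compositions_def intro!: bexI[of _ "hd js"])
qed (auto simp: compositions_def)

lemma sum_compositions_Suc:
  "(\<Sum>js\<in>compositions n (Suc d). f js) =
   (\<Sum>j=1..n. \<Sum>js\<in>compositions (n - j) d. f (j # js))"
  unfolding compositions_Suc
  by (subst sum.UNION_disjoint) (auto simp: finite_compositions sum.reindex)

lemma composition_series_0: "composition_series x N 0 = 1"
  by (rule fps_ext) (simp add: composition_series_def compositions_0)

lemma composition_series_no_factors: "composition_series x 0 (Suc d) = 0"
  by (rule fps_ext) (simp add: composition_series_def sum_compositions_Suc)

text \<open>Summing \<open>x m ^ j u ^ j\<close> over the admissible exponents \<open>j \<ge> 1\<close> of one index \<open>m\<close> gives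
  \<open>x m u / (1 - x m u)\<close>.\<close>

lemma geometric_tail_mult:
  "(1 - fps_const a * fps_X) * Abs_fps (\<lambda>j. if j = 0 then 0 else a ^ j) =
   fps_const (a::'a::comm_ring_1) * fps_X" (is "_ * ?G = _")
proof (rule fps_ext)
  fix n
  have "((1 - fps_const a * fps_X) * ?G) $ n = ?G $ n - a * (fps_X * ?G) $ n"
    by (simp add: algebra_simps mult.assoc)
  also have "\<dots> = (fps_const a * fps_X) $ n"
    by (cases n) auto
  finally show "((1 - fps_const a * fps_X) * ?G) $ n = (fps_const a * fps_X) $ n" .
qed

lemma composition_series_Suc:
  "composition_series x (Suc N) (Suc d) = composition_series x N (Suc d) +
     Abs_fps (\<lambda>j. if j = 0 then 0 else x (Suc N) ^ j) * composition_series x N d"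
  (is "_ = _ + ?G * _")
proof (rule fps_ext)
  fix n
  have "(?G * composition_series x N d) $ n =
      (\<Sum>j=0..n. ?G $ j * composition_series x N d $ (n - j))"
    by (simp add: fps_mult_nth)
  also have "\<dots> = (\<Sum>j=1..n. x (Suc N) ^ j * composition_series x N d $ (n - j))"
    by (rule sum.mono_neutral_cong_right) auto
  finally show "composition_series x (Suc N) (Suc d) $ n =
      (composition_series x N (Suc d) + ?G * composition_series x N d) $ n"
    by (simp add: composition_series_def sum_compositions_Suc sum.distrib sum_distrib_left)
qed

lemma partial_product_Suc:
  "partial_product x (Suc N) = (1 - fps_const (x (Suc N)) * fps_X) * partial_product x N"
  by (simp add: partial_product_def mult.commute)

lemma linear_factor_mult_nth_Suc:
  "((1 - fps_const (a::'a::comm_ring_1) * fps_X) * F) $ Suc n = F $ Suc n - a * F $ n"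
  by (simp add: left_diff_distrib mult.assoc)

text \<open>The coefficient of \<open>v ^ d\<close> in the finite identity
  \<open>(\<Prod>m\<le>N. 1 - x m u) (\<Prod>m\<le>N. 1 + v x m u / (1 - x m u)) = (\<Prod>m\<le>N. 1 - (1 - v) x m u)\<close>:
  the second product generates the truncated sums, and replacing \<open>u\<close> by \<open>(1 - v) u\<close>
  multiplies the coefficient of \<open>u ^ n\<close> by \<open>(1 - v) ^ n\<close>. Extracting the coefficient keeps
  everything in power series in one variable; the induction on \<open>N\<close> then rests on Pascal's
  rule.\<close>

lemma partial_product_mult_composition_series:
  "partial_product x N * composition_series x N d =
   Abs_fps (\<lambda>n. partial_product x N $ n * of_nat (n choose d) * (-1) ^ d)"
proof (induction N arbitrary: d)
  case 0
  show ?case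
    by (cases d; rule fps_ext)
       (auto simp: partial_product_def composition_series_0 composition_series_no_factors)
next
  case (Suc N)
  show ?case
  proof (cases d)
    case 0
    then show ?thesis by (simp add: composition_series_0 fps_eq_iff)
  next
    case (Suc e)
    define a where "a = x (Suc N)"
    define P where "P = partial_product x N"
    define R where "R = (\<lambda>d. Abs_fps (\<lambda>n. P $ n * of_nat (n choose d) * (-1) ^ d))"
    define G where "G = Abs_fps (\<lambda>j. if j = 0 then 0 else a ^ j)"
    let ?L = "1 - fps_const a * fps_X"
    have "partial_product x (Suc N) * composition_series x (Suc N) d =
        ?L * (P * composition_series x N (Suc e)) +
        (?L * G) * (P * composition_series x N e)"
      unfolding Suc composition_series_Suc partial_product_Suc P_def G_def a_def
      by (simp add: algebra_simps)
    also have "\<dots> = ?L * R (Suc e) + fps_const a * (fps_X * R e)"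
      unfolding G_def geometric_tail_mult P_def Suc.IH R_def by (simp add: mult.assoc)
    also have "\<dots> = Abs_fps (\<lambda>n. (?L * P) $ n * of_nat (n choose Suc e) * (-1) ^ Suc e)"
    proof (rule fps_ext)
      fix n
      show "(?L * R (Suc e) + fps_const a * (fps_X * R e)) $ n =
          Abs_fps (\<lambda>n. (?L * P) $ n * of_nat (n choose Suc e) * (-1) ^ Suc e) $ n"
      proof (cases n)
        case 0
        then show ?thesis by (simp add: R_def)
      next
        case (Suc m)
        then show ?thesis
          unfolding Suc fps_add_nth linear_factor_mult_nth_Suc
          by (simp add: R_def linear_factor_mult_nth_Suc algebra_simps)
      qed
    qed
    finally show ?thesis by (simp add: Suc partial_product_Suc P_def a_def)
  qed
qed

section \<open>Passage to the infinite multiple sums\<close>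

definition bounded_tuples :: "nat \<Rightarrow> nat \<Rightarrow> nat list set" where
  "bounded_tuples N d = {ns \<in> decreasing_tuples d. set ns \<subseteq> {..N}}"

lemma finite_bounded_tuples: "finite (bounded_tuples N d)"
  by (rule finite_subset[OF _ finite_lists_length_eq[of "{..N}" d]])
     (auto simp: bounded_tuples_def decreasing_tuples_def)

lemma bounded_tuples_0: "bounded_tuples N 0 = {[]}"
  by (auto simp: bounded_tuples_def decreasing_tuples_def)

lemma bounded_tuples_0_Suc: "bounded_tuples 0 (Suc d) = {}"
  by (auto simp: bounded_tuples_def decreasing_tuples_def length_Suc_conv)

lemma bounded_tuples_Suc_Suc:
  "bounded_tuples (Suc N) (Suc d) =
   bounded_tuples N (Suc d) \<union> (#) (Suc N) ` bounded_tuples N d"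
proof (intro equalityI subsetI)
  fix ns assume ns: "ns \<in> bounded_tuples (Suc N) (Suc d)"
  then obtain k ks where k: "ns = k # ks"
    by (auto simp: bounded_tuples_def decreasing_tuples_def length_Suc_conv)
  show "ns \<in> bounded_tuples N (Suc d) \<union> (#) (Suc N) ` bounded_tuples N d"
    using ns unfolding k
    by (cases "k = Suc N") (fastforce simp: bounded_tuples_def decreasing_tuples_def)+
qed (auto simp: bounded_tuples_def decreasing_tuples_def less_Suc_eq_le)

lemma sum_bounded_tuples:
  "(\<Sum>ns\<in>bounded_tuples N (length js). \<Prod>i<length js. x (ns ! i) ^ (js ! i)) =
   truncated_sum x N js"
proof (induction x N js rule: truncated_sum.induct)
  case (3 x N j js)
  have "bounded_tuples N (Suc d) \<inter> (#) (Suc N) ` bounded_tuples N d = {}" for d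
    by (auto simp: bounded_tuples_def)
  then have "(\<Sum>ns\<in>bounded_tuples (Suc N) (length (j # js)).
        \<Prod>i<length (j # js). x (ns ! i) ^ ((j # js) ! i)) =
      (\<Sum>ns\<in>bounded_tuples N (length (j # js)).
        \<Prod>i<length (j # js). x (ns ! i) ^ ((j # js) ! i)) +
      (\<Sum>ns\<in>bounded_tuples N (length js).
        x (Suc N) ^ j * (\<Prod>i<length js. x (ns ! i) ^ (js ! i)))"
    by (simp add: bounded_tuples_Suc_Suc sum.union_disjoint finite_bounded_tuples
        sum.reindex prod.lessThan_Suc_shift del: prod.lessThan_Suc)
  then show ?case
    using 3 by (simp only: sum_distrib_left[symmetric] truncated_sum.simps)
qed (simp_all add: bounded_tuples_0 bounded_tuples_0_Suc)

lemma truncated_sum_nonneg: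
  "(\<And>m. x m \<ge> (0::real)) \<Longrightarrow> truncated_sum x N js \<ge> 0"
  by (induction x N js rule: truncated_sum.induct) auto

text \<open>Dropping the condition that the indices decrease bounds the multiple sum by a product of
  single sums, and each exponent may be lowered to \<open>1\<close> because the terms lie in \<open>[0, 1]\<close>.\<close>

lemma truncated_sum_le:
  fixes y :: "nat \<Rightarrow> real"
  assumes y: "\<And>m. 0 \<le> y m" "\<And>m. y m \<le> 1" and js: "\<forall>j\<in>set js. j > 0"
    and C: "\<And>N. (\<Sum>m=1..N. y m) \<le> C"
  shows "truncated_sum y N js \<le> C ^ length js"
  using js
proof (induction js arbitrary: N)
  case Nil
  then show ?case by simp
next
  case (Cons j js)
  have "C \<ge> 0" using C[of 0] by simp
  have "truncated_sum y N (j # js) \<le> (\<Sum>m=1..N. y m) * C ^ length js"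
  proof (induction N)
    case (Suc N)
    have "y (Suc N) ^ j \<le> y (Suc N) ^ 1"
      using Cons.prems y by (intro power_decreasing) auto
    then have "y (Suc N) ^ j * truncated_sum y N js \<le> y (Suc N) * C ^ length js"
      using Cons y by (intro mult_mono) (auto intro: truncated_sum_nonneg)
    then show ?case using Suc by (simp add: algebra_simps)
  qed simp
  also have "\<dots> \<le> C * C ^ length js"
    by (intro mult_right_mono C) (simp add: \<open>C \<ge> 0\<close>)
  finally show ?case by simp
qed

text \<open>The bound \<open>truncated_sum_le\<close> for \<open>\<bar>x\<bar>\<close> is uniform in \<open>N\<close> and gives absolute summability;
  since the bounded tuples exhaust all decreasing tuples, the truncations converge to the sum.\<close>

lemma truncated_sum_tendsto:
  fixes x :: "nat \<Rightarrow> real"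
  assumes x: "\<And>m. \<bar>x m\<bar> \<le> 1" "summable (\<lambda>m. \<bar>x m\<bar>)" and js: "\<forall>j\<in>set js. j > 0"
  shows "(\<lambda>N. truncated_sum x N js) \<longlonglongrightarrow>
    (\<Sum>\<^sub>\<infinity>ns\<in>decreasing_tuples (length js). \<Prod>i<length js. x (ns ! i) ^ (js ! i))"
proof -
  let ?d = "length js"
  let ?t = "\<lambda>ns. \<Prod>i<?d. x (ns ! i) ^ (js ! i)"
  let ?C = "\<Sum>m. \<bar>x m\<bar>"
  have exhaust: "\<exists>M. \<forall>N\<ge>M. F \<subseteq> bounded_tuples N ?d"
    if F: "finite F" "F \<subseteq> decreasing_tuples ?d" for F
  proof -
    have "finite (\<Union>(set ` F))" using F by auto
    then obtain M where "\<Union>(set ` F) \<subseteq> {..M}"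
      using finite_nat_set_iff_bounded_le by (metis atMost_iff subsetI)
    then have "\<forall>N\<ge>M. F \<subseteq> bounded_tuples N ?d"
      using F by (fastforce simp: bounded_tuples_def)
    then show ?thesis ..
  qed
  have "(\<lambda>ns. norm (?t ns)) summable_on decreasing_tuples ?d"
    unfolding abs_summable_iff_bdd_above
  proof (rule bdd_aboveI2)
    fix F assume "F \<in> {F. F \<subseteq> decreasing_tuples ?d \<and> finite F}"
    then have "finite F" "F \<subseteq> decreasing_tuples ?d" by auto
    from exhaust[OF this] obtain N where N: "F \<subseteq> bounded_tuples N ?d" by auto
    have "(\<Sum>ns\<in>F. norm (?t ns)) \<le> (\<Sum>ns\<in>bounded_tuples N ?d. norm (?t ns))"
      by (rule sum_mono2[OF finite_bounded_tuples N]) simp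
    also have "\<dots> = truncated_sum (\<lambda>m. \<bar>x m\<bar>) N js"
      unfolding sum_bounded_tuples[symmetric] by (simp add: power_abs abs_prod)
    also have "\<dots> \<le> ?C ^ ?d"
      by (intro truncated_sum_le js x sum_le_suminf) auto
    finally show "(\<Sum>ns\<in>F. norm (?t ns)) \<le> ?C ^ ?d" .
  qed
  then have "(?t has_sum infsum ?t (decreasing_tuples ?d)) (decreasing_tuples ?d)"
    by (rule has_sum_infsum[OF abs_summable_summable])
  moreover have "filterlim (\<lambda>N. bounded_tuples N ?d)
      (finite_subsets_at_top (decreasing_tuples ?d)) sequentially"
    unfolding filterlim_finite_subsets_at_top eventually_sequentially
  proof (intro allI impI)
    fix F assume "finite F \<and> F \<subseteq> decreasing_tuples ?d"
    then have "finite F" "F \<subseteq> decreasing_tuples ?d" by auto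
    from exhaust[OF this] obtain M where "\<forall>N\<ge>M. F \<subseteq> bounded_tuples N ?d"
      by (elim exE)
    then show "\<exists>M. \<forall>N\<ge>M. finite (bounded_tuples N ?d) \<and> F \<subseteq> bounded_tuples N ?d \<and>
        bounded_tuples N ?d \<subseteq> decreasing_tuples ?d"
      using finite_bounded_tuples by (auto simp: bounded_tuples_def)
  qed
  ultimately show ?thesis
    unfolding has_sum_def sum_bounded_tuples[symmetric] by (rule filterlim_compose)
qed

text \<open>Raising this to the power \<open>s\<close> gives the factor \<open>(-1) ^ (s m) / m ^ (2 s)\<close> of \<open>xi\<close>, so that
  \<open>xi\<close> is a multiple power sum in a single sequence.\<close>

definition alt_inv_square :: "nat \<Rightarrow> real" where
  "alt_inv_square m = (-1) ^ m / real m ^ 2"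

lemma abs_alt_inv_square: "\<bar>alt_inv_square m\<bar> = 1 / real m ^ 2"
  by (simp add: alt_inv_square_def power_abs)

lemma summable_abs_alt_inv_square: "summable (\<lambda>m. \<bar>alt_inv_square m\<bar>)"
  using inverse_power_summable[of 2, where ?'a = real] by (simp add: abs_alt_inv_square field_simps)

lemma truncated_sum_tendsto_xi:
  assumes "\<forall>j\<in>set js. j > 0"
  shows "(\<lambda>N. truncated_sum alt_inv_square N js) \<longlonglongrightarrow> xi js"
proof -
  have "xi js = (\<Sum>\<^sub>\<infinity>ns\<in>decreasing_tuples (length js).
      \<Prod>i<length js. alt_inv_square (ns ! i) ^ (js ! i))"
    unfolding xi_def alt_inv_square_def
    by (simp add: power_divide mult.commute flip: power_mult)
  moreover have "\<bar>alt_inv_square m\<bar> \<le> 1" for m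
    by (cases "m = 0") (auto simp: abs_alt_inv_square divide_le_eq)
  ultimately show ?thesis
    using truncated_sum_tendsto[of alt_inv_square js] summable_abs_alt_inv_square assms by simp
qed

lemma composition_series_tendsto_Xi:
  "(\<lambda>N. composition_series alt_inv_square N d $ n) \<longlonglongrightarrow> Xi n d"
proof -
  have "\<forall>j\<in>set js. j > 0" if "js \<in> compositions n d" for js
    using that by (simp add: compositions_def)
  then show ?thesis
    unfolding composition_series_def Xi_def fps_nth_Abs_fps
    by (intro tendsto_sum truncated_sum_tendsto_xi)
qed

text \<open>The case distinction in the definition of \<open>phi\<close> and its constant term agree with the
  values of \<open>Xi\<close> outside \<open>1 \<le> d \<le> n\<close>: there are no compositions of \<open>n\<close> into more than \<open>n\<close>
  parts, and only \<open>0\<close> has an empty one.\<close>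

lemma phi_nth: "phi $ n $ d = Xi n d"
proof -
  have "Xi n d = 0" if "d > n"
  proof -
    have "length js \<le> sum_list js" if "\<forall>j\<in>set js. j > 0" for js :: "nat list"
      using that by (induction js) auto
    then have "compositions n d = {}" using \<open>d > n\<close> by (fastforce simp: compositions_def)
    then show ?thesis by (simp add: Xi_def)
  qed
  moreover have "decreasing_tuples 0 = {[]}" by (auto simp: decreasing_tuples_def)
  then have "xi [] = 1" by (simp add: xi_def)
  then have "Xi n 0 = (if n = 0 then 1 else 0)"
    by (simp add: Xi_def compositions_0)
  ultimately show ?thesis by (cases "d = 0") (auto simp: phi_def not_le)
qed

section \<open>The infinite product\<close>

definition sin_cosh :: "'a::field_char_0 \<Rightarrow> 'a fps" where
  "sin_cosh c = fps_sin c * fps_cosh c"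

lemma fps_cosh_nth: "fps_cosh c $ n = (if even n then c ^ n / fact n else 0)"
  by (simp add: fps_cosh_def)

lemma sin_cosh_nth_even: "even k \<Longrightarrow> sin_cosh c $ k = 0"
  unfolding sin_cosh_def fps_mult_nth
  by (intro sum.neutral) (auto simp: fps_cosh_nth fps_sin_def)

text \<open>The coefficients of \<open>sin (c t) cosh (c t)\<close> are rational multiples of powers of \<open>c\<close>. This is
  used for the embeddings of the reals into the complex numbers (to use complex analysis)
  and into the Laurent series in \<open>v\<close> (where the final identity lives).\<close>

lemma sin_cosh_nth_hom:
  fixes h :: "real \<Rightarrow> 'a::field_char_0"
  assumes add: "\<And>x y. h (x + y) = h x + h y" and mult: "\<And>x y. h (x * y) = h x * h y"
    and one: "h 1 = 1"
  shows "sin_cosh (h c * a) $ k = a ^ k * h (sin_cosh c $ k)"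
proof -
  have zero: "h 0 = 0" using add[of 0 0] by simp
  have neg: "h (- x) = - h x" for x using add[of x "- x"] zero by (simp add: add_eq_0_iff)
  have pow: "h (x ^ n) = h x ^ n" for x n by (induction n) (simp_all add: mult one)
  have nat: "h (of_nat n) = of_nat n" for n by (induction n) (simp_all add: add one zero)
  then have fact: "h (fact n) = fact n" for n by (metis of_nat_fact)
  have div: "h (x / fact n) = h x / fact n" for x n
    using mult[of "x / fact n" "fact n"] by (simp add: fact field_simps)
  have sum: "h (\<Sum>i\<in>A. f i) = (\<Sum>i\<in>A. h (f i))" for f and A :: "nat set"
    by (induction A rule: infinite_finite_induct) (simp_all add: zero add)
  have sin: "fps_sin (h c * a) $ n = a ^ n * h (fps_sin c $ n)" for n
    by (simp add: fps_sin_def div mult pow neg one zero power_mult_distrib)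
  have cosh: "fps_cosh (h c * a) $ n = a ^ n * h (fps_cosh c $ n)" for n
    by (simp add: fps_cosh_nth div pow zero power_mult_distrib)
  have "a ^ i * h x * (a ^ (k - i) * h y) = a ^ k * h (x * y)" if "i \<le> k" for i x y
  proof -
    have "a ^ k = a ^ i * a ^ (k - i)" using that by (simp flip: power_add)
    then show ?thesis by (simp add: mult)
  qed
  then show ?thesis
    by (simp add: sin_cosh_def fps_mult_nth sin cosh sum sum_distrib_left)
qed

lemma prod_split_parity:
  "(\<Prod>m=1..2 * M. g m) = (\<Prod>m=1..M. g (2 * m)) * (\<Prod>m=1..M. g (2 * m - 1 :: nat))"
  for g :: "nat \<Rightarrow> 'a::comm_monoid_mult"
  by (induction M) (simp_all add: ac_simps)

text \<open>Splitting Euler's product for \<open>sin (\<pi> w)\<close> by the parity of the index, the even factors form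
  the product for \<open>sin (\<pi> w / 2)\<close>; the odd ones therefore give the quotient
  \<open>sin (\<pi> w) / (2 sin (\<pi> w / 2))\<close>. The condition on \<open>w\<close> keeps the denominator nonzero
  except at \<open>w = 0\<close>; a neighbourhood of \<open>0\<close> is enough for comparing power series.\<close>

lemma cos_product_odd:
  fixes w :: complex
  assumes w: "norm w < 1"
  shows "(\<lambda>M. \<Prod>m=1..M. 1 - w ^ 2 / of_nat (2 * m - 1) ^ 2) \<longlonglongrightarrow> cos (of_real pi * w / 2)"
proof (cases "w = 0")
  case False
  define Odd where "Odd = (\<lambda>M. \<Prod>m=1..M. 1 - w ^ 2 / of_nat (2 * m - 1) ^ 2)"
  define S where "S = (\<lambda>w n. complex_of_real pi * w * (\<Prod>k=1..n. 1 - w ^ 2 / of_nat k ^ 2))"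
  have S: "S w \<longlonglongrightarrow> sin (of_real pi * w)" for w
    unfolding S_def by (rule sin_product_formula_complex)
  have double: "S w (2 * M) = 2 * S (w / 2) M * Odd M" for M
    unfolding S_def Odd_def prod_split_parity
    by (simp add: power_divide power_mult_distrib)
  (* The zeros of the sine occur at even integers w, and 0 < norm w < 1 excludes them. *)
  have nz: "sin (of_real pi * (w / 2)) \<noteq> 0"
  proof
    assume "sin (of_real pi * (w / 2)) = 0"
    then obtain n :: int where "w = of_int (2 * n)"
      by (auto simp: sin_eq_0 field_simps)
    then have "norm w = of_int \<bar>2 * n\<bar>" by (metis norm_of_int of_int_abs)
    then have "\<bar>2 * n\<bar> < 1" using w by linarith
    with \<open>w = _\<close> False show False by simp
  qed
  have "(\<lambda>M. S w (2 * M)) \<longlonglongrightarrow> sin (of_real pi * w)"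
    by (rule filterlim_compose[OF S]) (auto intro: mult_nat_left_at_top)
  then have "(\<lambda>M. S w (2 * M) / (2 * S (w / 2) M)) \<longlonglongrightarrow>
      sin (of_real pi * w) / (2 * sin (of_real pi * (w / 2)))"
    using nz by (intro tendsto_intros S) auto
  also have "sin (of_real pi * w) = 2 * sin (of_real pi * (w / 2)) * cos (of_real pi * w / 2)"
    using sin_double[of "of_real pi * (w / 2)"] by simp
  also have "\<dots> / (2 * sin (of_real pi * (w / 2))) = cos (of_real pi * w / 2)"
    using nz by simp
  finally show ?thesis
    unfolding Odd_def[symmetric]
  proof (rule Lim_transform_eventually)
    show "\<forall>\<^sub>F M in sequentially. S w (2 * M) / (2 * S (w / 2) M) = Odd M"
      using tendsto_imp_eventually_ne[OF S nz] by eventually_elim (simp add: double)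
  qed
qed simp

text \<open>The factors of even index are those of the sine product at \<open>z / 2\<close>, the factors of odd index
  those of the cosine product at \<open>\<i> z\<close>, which turns the cosine into a hyperbolic cosine.\<close>

lemma alt_product_tendsto:
  fixes z :: complex
  assumes "norm z < 1"
  shows "(\<lambda>M. of_real pi * (z / 2) * (\<Prod>m=1..2 * M. 1 - of_real (alt_inv_square m) * z ^ 2))
    \<longlonglongrightarrow> sin (of_real pi * (z / 2)) * cos (of_real pi * (\<i> * z) / 2)"
proof -
  have even: "1 - of_real (alt_inv_square (2 * m)) * z ^ 2 = 1 - (z / 2) ^ 2 / of_nat m ^ 2" for m
    by (simp add: alt_inv_square_def power_divide power_mult_distrib)
  have odd: "(\<Prod>m=1..M. 1 - of_real (alt_inv_square (2 * m - 1)) * z ^ 2) =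
      (\<Prod>m=1..M. 1 - (\<i> * z) ^ 2 / of_nat (2 * m - 1) ^ 2)" for M
    by (intro prod.cong refl) (simp add: alt_inv_square_def power_mult_distrib)
  have "norm (\<i> * z) < 1" using assms by (simp add: norm_mult)
  from tendsto_mult[OF sin_product_formula_complex[of "z / 2"] cos_product_odd[OF this]]
  show ?thesis
    unfolding prod_split_parity even odd by (simp only: mult.assoc)
qed

lemma partial_product_compose_nth:
  fixes x :: "nat \<Rightarrow> real"
  shows "(\<Prod>m=1..N. 1 - fps_const (of_real (x m) :: complex) * fps_X ^ 2) $ k =
    (if even k then of_real (partial_product x N $ (k div 2)) else 0)"
proof -
  define h where "h F = Abs_fps (\<lambda>n. complex_of_real (F $ n))" for F :: "real fps"
  have h_mult: "h (F * G) = h F * h G" for F G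
    by (rule fps_ext) (simp add: h_def fps_mult_nth)
  have h_one: "h 1 = 1" by (rule fps_ext) (simp add: h_def)
  have h_linear: "h (1 - fps_const a * fps_X) = 1 - fps_const (of_real a) * fps_X" for a
    by (rule fps_ext) (simp add: h_def fps_X_def)
  have "h (partial_product x N) = (\<Prod>m=1..N. 1 - fps_const (of_real (x m)) * fps_X)"
    unfolding partial_product_def
    by (induction N) (simp_all add: h_one h_mult h_linear)
  then have "h (partial_product x N) oo fps_X ^ 2 =
      (\<Prod>m=1..N. 1 - fps_const (of_real (x m)) * fps_X ^ 2)"
    by (simp add: fps_compose_prod_distrib fps_compose_sub_distrib fps_compose_mult_distrib)
  then have "(\<Prod>m=1..N. 1 - fps_const (of_real (x m) :: complex) * fps_X ^ 2) $ k =
      (h (partial_product x N) oo fps_X ^ 2) $ k" by simp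
  also have "\<dots> = (if even k then of_real (partial_product x N $ (k div 2)) else 0)"
    by (subst fps_nth_compose_X_power) (auto simp: h_def)
  finally show ?thesis .
qed

lemma uniformly_convergent_alt_product:
  "uniformly_convergent_on (cball 0 1)
     (\<lambda>N z :: complex. \<Prod>m=1..N. 1 - of_real (alt_inv_square m) * z ^ 2)"
proof -
  have "uniformly_convergent_on (cball 0 1)
      (\<lambda>N z :: complex. \<Prod>n<N. 1 + - (of_real (alt_inv_square (Suc n)) * z ^ 2))"
  proof (rule uniformly_convergent_on_prod)
    show "uniformly_convergent_on (cball 0 1)
        (\<lambda>N z :: complex. \<Sum>n<N. norm (- (of_real (alt_inv_square (Suc n)) * z ^ 2)))"
    proof (rule Weierstrass_m_test')
      show "summable (\<lambda>n. \<bar>alt_inv_square (Suc n)\<bar>)"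
        using summable_abs_alt_inv_square by (subst summable_Suc_iff)
      show "norm (norm (- (of_real (alt_inv_square (Suc n)) * z ^ 2))) \<le>
          \<bar>alt_inv_square (Suc n)\<bar>"
        if "z \<in> cball 0 1" for n and z :: complex
      proof -
        have "norm z ^ 2 \<le> 1" using that by (intro power_le_one) auto
        then have "\<bar>alt_inv_square (Suc n)\<bar> * norm z ^ 2 \<le> \<bar>alt_inv_square (Suc n)\<bar> * 1"
          by (rule mult_left_mono) simp
        then show ?thesis by (simp add: norm_mult norm_power)
      qed
    qed
  qed (auto intro!: continuous_intros)
  then show ?thesis
    by (simp add: prod.atLeast1_atMost_eq)
qed

text \<open>Pointwise convergence does not control coefficients, but locally uniform convergence of
  holomorphic functions does: their derivatives at \<open>0\<close> converge. The limit function is identified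
  by the pointwise result. Only even truncations \<open>2 M\<close> are considered, since for these the
  factors pair up by parity.\<close>

lemma partial_product_alt_inv_square_tendsto:
  "(\<lambda>M. partial_product alt_inv_square (2 * M) $ k) \<longlonglongrightarrow>
     2 / pi * sin_cosh (pi / 2) $ (2 * k + 1)"
proof -
  define f where "f = (\<lambda>N (z::complex). \<Prod>m=1..N. 1 - of_real (alt_inv_square m) * z ^ 2)"
  obtain L where "uniform_limit (cball 0 1) f L sequentially"
    using uniformly_convergent_alt_product unfolding uniformly_convergent_on_def f_def by blast
  then have "uniform_limit (cball 0 1) (\<lambda>M. f (2 * M)) L sequentially"
    by (rule filterlim_compose) (auto intro: mult_nat_left_at_top)
  then have lim: "uniform_limit (ball 0 1) (\<lambda>M. f (2 * M)) L sequentially"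
    by (rule uniform_limit_on_subset) auto
  have "L holomorphic_on ball 0 1"
  proof (rule holomorphic_uniform_sequence[where f = "\<lambda>M. f (2 * M)"])
    fix x :: complex assume "x \<in> ball 0 1"
    then obtain d where "d > 0" "cball x d \<subseteq> ball 0 1"
      by (meson open_ball open_contains_cball)
    then show "\<exists>d>0. cball x d \<subseteq> ball 0 1 \<and>
        uniform_limit (cball x d) (\<lambda>M. f (2 * M)) L sequentially"
      using uniform_limit_on_subset[OF lim] by blast
  qed (auto simp: f_def intro!: holomorphic_intros)
  then have L_exp: "L has_fps_expansion fps_expansion L 0"
    by (intro has_fps_expansion_fps_expansion[of "ball 0 1"]) auto

  (* Comparing the expansions of both sides at 0 determines the coefficients of L. *)
  have L_eq: "of_real (pi / 2) * z * L z = sin (of_real (pi / 2) * z) * cos (\<i> * of_real (pi / 2) * z)"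
    if z: "z \<in> ball 0 1" for z
  proof -
    have "(\<lambda>M. f (2 * M) z) \<longlonglongrightarrow> L z"
      using lim z by (rule tendsto_uniform_limitI)
    then have "(\<lambda>M. of_real pi * (z / 2) * f (2 * M) z) \<longlonglongrightarrow> of_real pi * (z / 2) * L z"
      by (intro tendsto_intros)
    then have "of_real pi * (z / 2) * L z = sin (of_real pi * (z / 2)) * cos (of_real pi * (\<i> * z) / 2)"
      unfolding f_def by (rule LIMSEQ_unique) (use z in \<open>intro alt_product_tendsto; simp\<close>)
    then show ?thesis by (simp add: mult_ac)
  qed
  have lhs: "(\<lambda>z. of_real (pi / 2) * z * L z) has_fps_expansion
      fps_const (of_real (pi / 2)) * fps_X * fps_expansion L 0"
    by (intro fps_expansion_intros L_exp)
  have rhs: "(\<lambda>z. sin (of_real (pi / 2) * z) * cos (\<i> * of_real (pi / 2) * z)) has_fps_expansion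
      fps_sin (of_real (pi / 2)) * fps_cos (\<i> * of_real (pi / 2))"
    by (intro fps_expansion_intros)
  have eq: "\<forall>\<^sub>F z in nhds 0. of_real (pi / 2) * z * L z =
      sin (of_real (pi / 2) * z) * cos (\<i> * of_real (pi / 2) * z)"
    by (rule eventually_mono[OF eventually_nhds_in_open[of "ball 0 1"]]) (simp, simp, rule L_eq)
  have "fps_const (of_real (pi / 2)) * fps_X * fps_expansion L 0 =
      fps_sin (of_real (pi / 2)) * fps_cos (\<i> * of_real (pi / 2))"
    by (rule fps_expansion_unique_complex[OF lhs iffD2[OF has_fps_expansion_cong[OF eq refl] rhs]])
  also have "\<dots> = sin_cosh (of_real (pi / 2))"
  proof -
    have "fps_cos (\<i> * c) = fps_cosh c" for c
      by (rule fps_ext) (auto simp: fps_cos_def fps_cosh_nth power_mult_distrib elim!: evenE)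
    then show ?thesis by (simp only: sin_cosh_def)
  qed
  finally have "(fps_const (of_real (pi / 2)) * fps_X * fps_expansion L 0) $ (2 * k + 1) =
      sin_cosh (complex_of_real (pi / 2) * 1) $ (2 * k + 1)" by simp
  also have "\<dots> = 1 ^ (2 * k + 1) * complex_of_real (sin_cosh (pi / 2) $ (2 * k + 1))"
    by (rule sin_cosh_nth_hom) simp_all
  finally have coeff: "fps_expansion L 0 $ (2 * k) =
      of_real (2 / pi * sin_cosh (pi / 2) $ (2 * k + 1))"
    by (simp add: mult.assoc field_simps)

  have "(\<lambda>M. (deriv ^^ (2 * k)) (f (2 * M)) 0 / fact (2 * k))
      \<longlonglongrightarrow> (deriv ^^ (2 * k)) L 0 / fact (2 * k)"
    by (intro tendsto_divide higher_deriv_complex_uniform_limit[OF lim])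
       (auto simp: f_def intro!: always_eventually holomorphic_intros)
  moreover have "(deriv ^^ (2 * k)) (f N) 0 / fact (2 * k) =
      of_real (partial_product alt_inv_square N $ k)" for N
  proof -
    have "f N has_fps_expansion (\<Prod>m=1..N. 1 - fps_const (of_real (alt_inv_square m)) * fps_X ^ 2)"
      unfolding f_def by (intro fps_expansion_intros)
    from fps_nth_fps_expansion[OF this, of "2 * k"] show ?thesis
      by (simp only: partial_product_compose_nth) simp
  qed
  ultimately have "(\<lambda>M. complex_of_real (partial_product alt_inv_square (2 * M) $ k)) \<longlonglongrightarrow>
      of_real (2 / pi * sin_cosh (pi / 2) $ (2 * k + 1))"
    unfolding coeff[symmetric] by (simp add: fps_expansion_def)
  then show ?thesis by (simp only: tendsto_of_real_iff)
qed

section \<open>The generating function\<close>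

text \<open>The limit of \<open>partial_product_mult_composition_series\<close> as \<open>N\<close> runs through the even
  numbers. The constant \<open>2 / \<pi>\<close> from \<open>partial_product_alt_inv_square_tendsto\<close> occurs on both sides.\<close>

lemma Xi_convolution:
  "(\<Sum>i=0..n. Xi i d * sin_cosh (pi / 2) $ (2 * (n - i) + 1)) =
   sin_cosh (pi / 2) $ (2 * n + 1) * of_nat (n choose d) * (-1) ^ d"
proof -
  let ?Q = "\<lambda>k. 2 / pi * sin_cosh (pi / 2) $ (2 * k + 1)"
  have "(\<lambda>M. composition_series alt_inv_square (2 * M) d $ i) \<longlonglongrightarrow> Xi i d" for i
    by (rule filterlim_compose[OF composition_series_tendsto_Xi])
       (auto intro: mult_nat_left_at_top)
  then have "(\<lambda>M. \<Sum>i=0..n. composition_series alt_inv_square (2 * M) d $ i *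
      partial_product alt_inv_square (2 * M) $ (n - i)) \<longlonglongrightarrow> (\<Sum>i=0..n. Xi i d * ?Q (n - i))"
    by (intro tendsto_intros partial_product_alt_inv_square_tendsto)
  moreover have "(\<Sum>i=0..n. composition_series alt_inv_square N d $ i *
        partial_product alt_inv_square N $ (n - i)) =
      partial_product alt_inv_square N $ n * of_nat (n choose d) * (-1) ^ d" for N
    using arg_cong[OF partial_product_mult_composition_series[of alt_inv_square N d], of "\<lambda>F. F $ n"]
    by (simp add: mult.commute[of "partial_product alt_inv_square N"] fps_mult_nth)
  ultimately have "(\<lambda>M. partial_product alt_inv_square (2 * M) $ n * of_nat (n choose d) * (-1) ^ d)
      \<longlonglongrightarrow> (\<Sum>i=0..n. Xi i d * ?Q (n - i))" by simp
  moreover have "(\<lambda>M. partial_product alt_inv_square (2 * M) $ n * of_nat (n choose d) * (-1) ^ d)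
      \<longlonglongrightarrow> ?Q n * of_nat (n choose d) * (-1) ^ d"
    by (intro tendsto_intros partial_product_alt_inv_square_tendsto)
  ultimately have "(\<Sum>i=0..n. Xi i d * ?Q (n - i)) = ?Q n * of_nat (n choose d) * (-1) ^ d"
    by (rule LIMSEQ_unique)
  also have "(\<Sum>i=0..n. Xi i d * ?Q (n - i)) =
      2 / pi * (\<Sum>i=0..n. Xi i d * sin_cosh (pi / 2) $ (2 * (n - i) + 1))"
    by (simp add: sum_distrib_left mult_ac)
  finally show ?thesis by simp
qed

lemma one_minus_fps_X_power_nth:
  "((1 - fps_X :: 'a::comm_ring_1 fps) ^ n) $ d = of_nat (n choose d) * (-1) ^ d"
proof (induction n arbitrary: d)
  case (Suc n)
  show ?case
    using linear_factor_mult_nth_Suc[of 1 "(1 - fps_X :: 'a fps) ^ n"] Suc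
    by (cases d) (simp_all add: algebra_simps)
qed (auto simp: binomial_eq_0)

text \<open>This is \<open>sin (\<pi> t / 2) cosh (\<pi> t / 2) / t\<close> at \<open>t = \<surd>(b u)\<close>, which is a power series in \<open>u\<close>
  because the numerator is odd in \<open>t\<close>.\<close>

definition sin_cosh_scaled :: "real fps \<Rightarrow> real fps fps" where
  "sin_cosh_scaled b = Abs_fps (\<lambda>n. b ^ n * fps_const (sin_cosh (pi / 2) $ (2 * n + 1)))"

text \<open>The identity to be proved with denominators cleared and square roots removed: for each
  coefficient of \<open>u ^ n v ^ d\<close> it is \<open>Xi_convolution\<close>.\<close>

lemma phi_mult_sin_cosh: "phi * sin_cosh_scaled 1 = sin_cosh_scaled (1 - fps_X)"
proof (intro fps_ext)
  fix n d
  show "(phi * sin_cosh_scaled 1) $ n $ d = sin_cosh_scaled (1 - fps_X) $ n $ d"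
    using Xi_convolution[where n = n and d = d]
    by (simp add: sin_cosh_scaled_def fps_mult_nth[of phi] fps_sum_nth phi_nth
        one_minus_fps_X_power_nth mult_ac)
qed

lemma fps_to_fls_sum: "fps_to_fls (\<Sum>i\<in>A. f i) = (\<Sum>i\<in>A. fps_to_fls (f i))"
  by (induction A rule: infinite_finite_induct) simp_all

lemma at_sqrt_u_mult: "at_sqrt_u (F * G) = at_sqrt_u F * at_sqrt_u G"
proof -
  have "Abs_fps (\<lambda>n. fps_to_fls ((F * G) $ n)) =
      Abs_fps (\<lambda>n. fps_to_fls (F $ n)) * Abs_fps (\<lambda>n. fps_to_fls (G $ n))"
    by (rule fps_ext) (simp add: fps_mult_nth fps_to_fls_sum fls_times_fps_to_fls)
  then show ?thesis
    unfolding at_sqrt_u_def by (simp add: fps_compose_mult_distrib)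
qed

lemma sin_cosh_eq_at_sqrt_u:
  assumes a: "a ^ 2 = fps_to_fls b"
  shows "sin_cosh (half_pi * a) = fps_const a * (fps_X * at_sqrt_u (sin_cosh_scaled b))"
proof (rule fps_ext)
  fix k
  have "sin_cosh (half_pi * a) $ k = a ^ k * fls_const (sin_cosh (pi / 2) $ k)"
    unfolding half_pi_def by (rule sin_cosh_nth_hom) (simp_all add: fls_plus_const)
  also have "\<dots> = (fps_const a * (fps_X * at_sqrt_u (sin_cosh_scaled b))) $ k"
  proof (cases "even k")
    case True
    then show ?thesis by (simp add: sin_cosh_nth_even at_sqrt_u_nth)
  next
    case False
    then obtain n where k: "k = 2 * n + 1" by (elim oddE)
    then show ?thesis
      by (simp add: at_sqrt_u_nth sin_cosh_scaled_def fls_times_fps_to_fls power_mult a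
          fps_to_fls_power)
  qed
  finally show "sin_cosh (half_pi * a) $ k =
      (fps_const a * (fps_X * at_sqrt_u (sin_cosh_scaled b))) $ k" .
qed

text \<open>After multiplication by \<open>\<surd>(1 - v) sin (\<pi> t / 2) cosh (\<pi> t / 2)\<close> the identity is
  \<open>phi_mult_sin_cosh\<close> times \<open>\<surd>(1 - v) t\<close>. Dividing again needs care only for the sine in
  the denominator, which is not a unit: there the numerator is exhibited as a multiple of the
  denominator, using that both hyperbolic cosines are units.\<close>

theorem theorem1p2:
  shows "at_sqrt_u phi =
    fps_sin (half_pi * sqrt_1_minus_v) / (fps_const sqrt_1_minus_v * fps_sin half_pi) *
    (fps_cosh (half_pi * sqrt_1_minus_v) / fps_cosh half_pi)"
proof -
  define s where "s = sqrt_1_minus_v"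
  define A B where "A = fps_const s * fps_sin half_pi" and "B = fps_sin (half_pi * s)"
  define C D where "C = fps_cosh half_pi" and "D = fps_cosh (half_pi * s)"
  have s2: "s ^ 2 = fps_to_fls (1 - fps_X)"
    by (simp add: s_def sqrt_1_minus_v_power2)
  then have "s \<noteq> 0" by (metis fps_to_fls_eq_0_iff fps_X_neq_one right_minus_eq zero_power2)
  have "fps_sin half_pi $ 1 \<noteq> 0"
    by (simp add: half_pi_def)
  then have "fps_sin half_pi \<noteq> 0" by (metis fps_zero_nth)
  then have A: "A \<noteq> 0"
    using \<open>s \<noteq> 0\<close> by (auto simp: A_def)
  have C: "C $ 0 = 1" and D: "D $ 0 = 1"
    by (simp_all add: C_def D_def fps_cosh_nth)
  have "sin_cosh half_pi = fps_X * at_sqrt_u (sin_cosh_scaled 1)"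
    using sin_cosh_eq_at_sqrt_u[of 1 1] by simp
  then have "at_sqrt_u phi * (fps_const s * sin_cosh half_pi) =
      fps_const s * (fps_X * at_sqrt_u (phi * sin_cosh_scaled 1))"
    by (simp add: at_sqrt_u_mult mult_ac)
  also have "\<dots> = sin_cosh (half_pi * s)"
    by (simp add: phi_mult_sin_cosh sin_cosh_eq_at_sqrt_u[OF s2])
  finally have "B * D = at_sqrt_u phi * C * A"
    by (simp add: sin_cosh_def A_def B_def C_def D_def mult_ac)
  then have "B * (D * inverse D) = (at_sqrt_u phi * C * inverse D) * A"
    by (simp add: mult_ac)
  then have "B = (at_sqrt_u phi * C * inverse D) * A"
    using D by (simp add: inverse_mult_eq_1')
  then have "B / A = at_sqrt_u phi * C * inverse D"
    using A by (simp add: nonzero_mult_div_cancel_right)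
  moreover have "D / C = D * inverse C"
    using C by (simp add: fps_divide_unit)
  ultimately have "B / A * (D / C) = at_sqrt_u phi * (C * inverse C) * (D * inverse D)"
    by (simp add: mult_ac)
  also have "\<dots> = at_sqrt_u phi"
    using C D by (simp add: inverse_mult_eq_1')
  finally show ?thesis by (simp add: A_def B_def C_def D_def s_def)
qed

end
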